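(* Let $n\ge3$. The quasi-isometric distortion growth for the hyperbolic space $\mathbb{H}^n$ and a regular tree $T$ is linear in $R$: there exist constants $C>0$ and $R_0>0$ such that for all $R\ge R_0$, $$C^{-1}R\le D_G(\mathbb{H}^n,x_0,T,y_0)(R)\le C R.$$
   Context: For metric spaces $X,Y$ with base points $x_0,y_0$, the quasi-isometric distortion growth is $$D_G(X,x_0,Y,y_0)(R)=\inf\{\lambda_f+c_f\},$$ the infimum being over all maps $f:B_X(x_0,R)\to Y$ that are $(\lambda_f,c_f)$-quasi-isometric embeddings with $f(x_0)=y_0$. A map $f:E\to F$ is a $(\lambda,c)$-quasi-isometric embedding ($\lambda>0,c\ge0$) if $\frac1\lambda(d(x,y)-c)\le d(f(x),f(y))\le\lambda d(x,y)+c$ for all $x,y\in E$. A regular tree is an infinite tree all of whose vertices have the same finite degree, with the graph distance; $y_0$ is a vertex. *)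

theory Defs
  imports "HOL-Analysis.Analysis"
begin

definition quasi_isometric_embedding_on ::
  "'a set \<Rightarrow> 'a metric \<Rightarrow> 'b metric \<Rightarrow> real \<Rightarrow> real \<Rightarrow> ('a \<Rightarrow> 'b) \<Rightarrow> bool"
  where "quasi_isometric_embedding_on E X Y L c f \<longleftrightarrow>
    0 < L \<and> 0 \<le> c \<and> E \<subseteq> mspace X \<and> f \<in> E \<rightarrow> mspace Y \<and>
    (\<forall>x\<in>E. \<forall>y\<in>E. 1 / L * (mdist X x y - c) \<le> mdist Y (f x) (f y) \<and>
                 mdist Y (f x) (f y) \<le> L * mdist X x y + c)"

definition distortion_growth :: "'a metric \<Rightarrow> 'a \<Rightarrow> 'b metric \<Rightarrow> 'b \<Rightarrow> real \<Rightarrow> real"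
  where "distortion_growth X x\<^sub>0 Y y\<^sub>0 R =
    Inf {L + c | L c. \<exists>f. quasi_isometric_embedding_on (mball_of X x\<^sub>0 R) X Y L c f \<and> f x\<^sub>0 = y\<^sub>0}"

text \<open>The infimum above is never taken over the empty set (for base points in the two spaces),
  and the set is bounded below, so the conventions for \<^const>\<open>Inf\<close> on the reals do not matter.\<close>

lemma quasi_isometric_embedding_on_const:
  assumes "x\<^sub>0 \<in> mspace X" "y\<^sub>0 \<in> mspace Y" "0 \<le> R"
  shows "quasi_isometric_embedding_on (mball_of X x\<^sub>0 R) X Y 1 (2 * R) (\<lambda>_. y\<^sub>0)"
proof -
  have diam: "mdist X x y \<le> 2 * R" if "x \<in> mball_of X x\<^sub>0 R" "y \<in> mball_of X x\<^sub>0 R" for x y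
    using that mdist_triangle[of x X x\<^sub>0 y] mdist_commute[of X x x\<^sub>0] by auto
  have zero: "mdist Y y\<^sub>0 y\<^sub>0 = 0"
    using assms by simp
  show ?thesis
    unfolding quasi_isometric_embedding_on_def
  proof (intro conjI ballI)
    fix x y
    assume "x \<in> mball_of X x\<^sub>0 R" "y \<in> mball_of X x\<^sub>0 R"
    then show "1 / 1 * (mdist X x y - 2 * R) \<le> mdist Y y\<^sub>0 y\<^sub>0"
      using diam zero by simp
    show "mdist Y y\<^sub>0 y\<^sub>0 \<le> 1 * mdist X x y + 2 * R"
      using zero assms(3) mdist_nonneg[of X x y] by linarith
  qed (use assms in auto)
qed

lemma bdd_below_distortion:
  "bdd_below {L + c | L c. \<exists>f. quasi_isometric_embedding_on (mball_of X x\<^sub>0 R) X Y L c f \<and> f x\<^sub>0 = y\<^sub>0}"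
  by (rule bdd_belowI[of _ 0]) (auto simp: quasi_isometric_embedding_on_def)

text \<open>The upper half-space model: the half-space of \<open>\<real>\<^sup>n\<close>, where \<open>\<real>\<^sup>n\<close> is the type
  \<open>'a \<times> real\<close> and \<open>n = DIM('a \<times> real) = DIM('a) + 1\<close>.\<close>

definition upper_half_space :: "('a::euclidean_space \<times> real) set"
  where "upper_half_space = {p. 0 < snd p}"

text \<open>The value outside the half-space is fixed only because \<^locale>\<open>Metric_space\<close> asks for symmetry
  and nonnegativity on the whole type.\<close>

definition hyperbolic_dist :: "'a::euclidean_space \<times> real \<Rightarrow> 'a \<times> real \<Rightarrow> real"
  where "hyperbolic_dist p q =
    (if p \<in> upper_half_space \<and> q \<in> upper_half_space
     then arcosh (1 + (dist p q)\<^sup>2 / (2 * snd p * snd q)) else 0)"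

definition hyperbolic_space :: "('a::euclidean_space \<times> real) metric"
  where "hyperbolic_space = metric (upper_half_space, hyperbolic_dist)"

lemma ptolemy_inequality_0:
  fixes a b c :: "'a::real_inner"
  shows "dist a c * norm b \<le> dist a b * norm c + dist b c * norm a"
proof (cases "a = 0 \<or> b = 0 \<or> c = 0")
  case True
  then show ?thesis
    by (auto simp: dist_norm mult.commute norm_minus_commute)
next
  case False
  define inv :: "'a \<Rightarrow> 'a" where "inv v = v /\<^sub>R (norm v)\<^sup>2" for v
  have inv: "dist (inv u) (inv v) = dist u v / (norm u * norm v)" if "u \<noteq> 0" "v \<noteq> 0" for u v
  proof -
    have "(dist (inv u) (inv v))\<^sup>2 =
        (norm (inv u))\<^sup>2 + (norm (inv v))\<^sup>2 - 2 * inner (inv u) (inv v)"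
      by (simp add: dist_norm power2_norm_eq_inner inner_diff_left inner_diff_right inner_commute)
    also have "\<dots> = 1 / (norm u)\<^sup>2 + 1 / (norm v)\<^sup>2 - 2 * inner u v / ((norm u)\<^sup>2 * (norm v)\<^sup>2)"
      using that by (simp add: inv_def power2_eq_square divide_simps)
    also have "\<dots> = ((norm u)\<^sup>2 + (norm v)\<^sup>2 - 2 * inner u v) / ((norm u)\<^sup>2 * (norm v)\<^sup>2)"
      using that by (simp add: field_simps)
    also have "(norm u)\<^sup>2 + (norm v)\<^sup>2 - 2 * inner u v = (dist u v)\<^sup>2"
      by (simp add: dist_norm power2_norm_eq_inner inner_diff_left inner_diff_right inner_commute)
    finally have "(dist (inv u) (inv v))\<^sup>2 = (dist u v / (norm u * norm v))\<^sup>2"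
      by (simp add: power_divide power_mult_distrib)
    then show ?thesis
      by (simp add: power2_eq_iff_nonneg)
  qed
  have "dist (inv a) (inv c) \<le> dist (inv a) (inv b) + dist (inv b) (inv c)"
    by (rule dist_triangle)
  then show ?thesis
    using False by (simp add: inv field_simps)
qed

lemma ptolemy_inequality:
  fixes a b c d :: "'a::real_inner"
  shows "dist a c * dist b d \<le> dist a b * dist c d + dist b c * dist a d"
  using ptolemy_inequality_0[of "a - d" "c - d" "b - d"] by (simp add: dist_norm)

lemma hyperbolic_dist_sinh_cosh:
  fixes p q :: "'a::euclidean_space \<times> real"
  assumes "p \<in> upper_half_space" "q \<in> upper_half_space"
  shows "sinh (hyperbolic_dist p q / 2) = dist p q / (2 * sqrt (snd p * snd q))"
    and "cosh (hyperbolic_dist p q / 2) = dist p (fst q, - snd q) / (2 * sqrt (snd p * snd q))"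
    and "0 \<le> hyperbolic_dist p q"
proof -
  have pos: "0 < snd p" "0 < snd q" "0 < snd p * snd q"
    using assms by (auto simp: upper_half_space_def)
  define y where "y = arsinh (dist p q / (2 * sqrt (snd p * snd q)))"
  have sinh_y: "sinh y = dist p q / (2 * sqrt (snd p * snd q))"
    by (simp add: y_def)
  have y: "0 \<le> y"
    using sinh_y pos by (metis sinh_real_nonneg_iff zero_le_dist zero_le_divide_iff
        mult_nonneg_nonneg real_sqrt_ge_zero less_imp_le zero_le_numeral)
  have sq: "(sinh y)\<^sup>2 = (dist p q)\<^sup>2 / (4 * snd p * snd q)"
    using pos by (simp add: sinh_y power_divide power_mult_distrib)
  have "cosh (2 * y) = 1 + (dist p q)\<^sup>2 / (2 * snd p * snd q)"
    by (simp add: cosh_double cosh_square_eq sq)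
  then have eq: "hyperbolic_dist p q = 2 * y"
    using assms y by (simp add: hyperbolic_dist_def flip: \<open>cosh (2 * y) = _\<close>)
      (simp add: arcosh_cosh_real)
  have refl: "(dist p (fst q, - snd q))\<^sup>2 = (dist p q)\<^sup>2 + 4 * snd p * snd q"
    by (cases p; cases q) (simp add: dist_Pair_Pair dist_real_def,
        simp add: power2_eq_square algebra_simps)
  have "(cosh y)\<^sup>2 = (dist p (fst q, - snd q) / (2 * sqrt (snd p * snd q)))\<^sup>2"
    using pos by (simp add: cosh_square_eq sq power_divide power_mult_distrib refl field_simps)
  then have "cosh y = dist p (fst q, - snd q) / (2 * sqrt (snd p * snd q))"
    using pos by (subst (asm) power2_eq_iff_nonneg) auto
  then show "sinh (hyperbolic_dist p q / 2) = dist p q / (2 * sqrt (snd p * snd q))"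
    and "cosh (hyperbolic_dist p q / 2) = dist p (fst q, - snd q) / (2 * sqrt (snd p * snd q))"
    and "0 \<le> hyperbolic_dist p q"
    using y by (simp_all add: eq sinh_y)
qed

lemma Metric_space_hyperbolic: "Metric_space upper_half_space hyperbolic_dist"
proof
  fix p q r :: "'a \<times> real"
  show "0 \<le> hyperbolic_dist p q"
    using hyperbolic_dist_sinh_cosh(3)[of p q]
    by (cases "p \<in> upper_half_space \<and> q \<in> upper_half_space") (auto simp: hyperbolic_dist_def)
  show "hyperbolic_dist p q = hyperbolic_dist q p"
    by (simp add: hyperbolic_dist_def dist_commute mult_ac conj_commute)
  assume p: "p \<in> upper_half_space" and q: "q \<in> upper_half_space"
  then have pq: "0 < snd p" "0 < snd q"
    by (auto simp: upper_half_space_def)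
  have "hyperbolic_dist p q = 0 \<longleftrightarrow> sinh (hyperbolic_dist p q / 2) = 0"
    by simp
  also have "\<dots> \<longleftrightarrow> p = q"
    using pq by (simp add: hyperbolic_dist_sinh_cosh(1)[OF p q])
  finally show "hyperbolic_dist p q = 0 \<longleftrightarrow> p = q" .
  assume r: "r \<in> upper_half_space"
  then have pqr: "0 < snd p" "0 < snd q" "0 < snd r"
    using pq by (auto simp: upper_half_space_def)
  let ?s = "\<lambda>v. (fst v, - snd v)"
  have refl: "dist u (?s v) = dist v (?s u)" for u v :: "'a \<times> real"
    by (cases u; cases v) (simp add: dist_Pair_Pair dist_commute dist_real_def add.commute)
  have "dist q (?s q) = 2 * snd q"
    using pqr by (cases q) (simp add: dist_Pair_Pair dist_real_def real_sqrt_mult)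
  then have pt: "dist p r * (2 * snd q) \<le> dist p q * dist q (?s r) + dist q r * dist p (?s q)"
    using ptolemy_inequality[of p r q "?s q"] refl[of q r] by (simp add: dist_commute)
  define a b c where "a = sqrt (snd p)" "b = sqrt (snd q)" "c = sqrt (snd r)"
  have abc: "0 < a" "0 < b" "0 < c" "snd q = b * b"
    using pqr by (auto simp: a_b_c_def)
  have "sinh (hyperbolic_dist p r / 2) = dist p r / (2 * (a * c))"
    by (simp add: hyperbolic_dist_sinh_cosh(1)[OF p r] real_sqrt_mult a_b_c_def)
  also have "\<dots> = dist p r * (2 * snd q) / (4 * a * b * b * c)"
    using abc by (simp add: field_simps)
  also have "\<dots> \<le> (dist p q * dist q (?s r) + dist q r * dist p (?s q)) / (4 * a * b * b * c)"
    using pt abc by (intro divide_right_mono) auto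
  also have "\<dots> = dist p q / (2 * (a * b)) * (dist q (?s r) / (2 * (b * c)))
                + dist p (?s q) / (2 * (a * b)) * (dist q r / (2 * (b * c)))"
    using abc by (simp add: field_simps)
  also have "\<dots> = sinh (hyperbolic_dist p q / 2 + hyperbolic_dist q r / 2)"
    by (simp add: sinh_add hyperbolic_dist_sinh_cosh[OF p q] hyperbolic_dist_sinh_cosh[OF q r]
        real_sqrt_mult a_b_c_def)
  finally show "hyperbolic_dist p r \<le> hyperbolic_dist p q + hyperbolic_dist q r"
    by simp
qed

lemma mspace_hyperbolic_space [simp]: "mspace hyperbolic_space = upper_half_space"
  and mdist_hyperbolic_space [simp]: "mdist hyperbolic_space = hyperbolic_dist"
  by (simp_all add: hyperbolic_space_def Metric_space_hyperbolic
      Metric_space.mspace_metric Metric_space.mdist_metric)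

text \<open>An undirected edge is represented by its two orientations.\<close>

definition simple_graph :: "'b set \<Rightarrow> 'b rel \<Rightarrow> bool"
  where "simple_graph V E \<longleftrightarrow> E \<subseteq> V \<times> V \<and> sym E \<and> irrefl E"

definition connected_graph :: "'b set \<Rightarrow> 'b rel \<Rightarrow> bool"
  where "connected_graph V E \<longleftrightarrow> simple_graph V E \<and> V \<noteq> {} \<and> (\<forall>u\<in>V. \<forall>v\<in>V. (u, v) \<in> E\<^sup>*)"

definition graph_cycle :: "'b rel \<Rightarrow> 'b list \<Rightarrow> bool"
  where "graph_cycle E p \<longleftrightarrow>
    3 \<le> length p \<and> distinct p \<and> successively (\<lambda>u v. (u, v) \<in> E) p \<and> (last p, hd p) \<in> E"

definition tree_graph :: "'b set \<Rightarrow> 'b rel \<Rightarrow> bool"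
  where "tree_graph V E \<longleftrightarrow> connected_graph V E \<and> (\<nexists>p. graph_cycle E p)"

definition regular_tree :: "'b set \<Rightarrow> 'b rel \<Rightarrow> bool"
  where "regular_tree V E \<longleftrightarrow>
    tree_graph V E \<and> infinite V \<and> (\<exists>k. \<forall>v\<in>V. finite (E `` {v}) \<and> card (E `` {v}) = k)"

definition graph_dist :: "'b rel \<Rightarrow> 'b \<Rightarrow> 'b \<Rightarrow> nat"
  where "graph_dist E u v = (LEAST n. (u, v) \<in> E ^^ n)"

definition graph_metric :: "'b set \<Rightarrow> 'b rel \<Rightarrow> 'b metric"
  where "graph_metric V E = metric (V, \<lambda>u v. real (graph_dist E u v))"

lemma Metric_space_graph:
  assumes "connected_graph V E"
  shows "Metric_space V (\<lambda>u v. real (graph_dist E u v))"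
proof
  have sym: "E\<inverse> = E"
    using assms by (simp add: connected_graph_def simple_graph_def sym_conv_converse_eq)
  have "(E ^^ n)\<inverse> = E ^^ n" for n
    by (induction n) (simp_all add: converse_relcomp sym relpow_commute)
  then have symn: "(u, v) \<in> E ^^ n \<longleftrightarrow> (v, u) \<in> E ^^ n" for u v n
    by (metis converse_iff)
  have path: "(u, v) \<in> E ^^ graph_dist E u v" if "u \<in> V" "v \<in> V" for u v
    using that assms unfolding connected_graph_def graph_dist_def
    by (metis (mono_tags, lifting) LeastI_ex rtrancl_imp_relpow)
  fix u v w
  show "0 \<le> real (graph_dist E u v)"
    by simp
  show "real (graph_dist E u v) = real (graph_dist E v u)"
    by (simp add: graph_dist_def symn[of u v])
  assume u: "u \<in> V" and v: "v \<in> V"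
  show "real (graph_dist E u v) = 0 \<longleftrightarrow> u = v"
    using path[OF u v] by (auto simp: graph_dist_def)
  assume w: "w \<in> V"
  have "(u, w) \<in> E ^^ (graph_dist E u v + graph_dist E v w)"
    using path[OF u v] path[OF v w] by (auto simp: relpow_add)
  then have "graph_dist E u w \<le> graph_dist E u v + graph_dist E v w"
    unfolding graph_dist_def[of E u w] by (rule Least_le)
  then show "real (graph_dist E u w) \<le> real (graph_dist E u v) + real (graph_dist E v w)"
    by simp
qed

lemma
  assumes "regular_tree V E"
  shows mspace_graph_metric: "mspace (graph_metric V E) = V"
    and mdist_graph_metric: "mdist (graph_metric V E) u v = real (graph_dist E u v)"
  using Metric_space_graph[of V E] assms
  by (simp_all add: graph_metric_def regular_tree_def tree_graph_def
      Metric_space.mspace_metric Metric_space.mdist_metric)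

end

theory Submission
  imports Defs
begin

text \<open>A constant map gives the upper bound. For the lower bound, let \<open>f\<close> be an \<open>(L, c)\<close>-quasi-isometric
  embedding of the ball of radius \<open>R\<close>. A horosphere of hyperbolic \<open>n\<close>-space is a Euclidean space of dimension
  \<open>n - 1 \<ge> 2\<close> on which the Euclidean distance is exponential in the hyperbolic one. So the ball contains an
  \<open>N \<times> N\<close> grid, with \<open>N\<close> of the order of \<open>exp (R / 2)\<close>, whose neighbouring points are at a bounded
  hyperbolic distance and are therefore mapped to vertices at distance at most \<open>r = \<lfloor>2 L + c\<rfloor>\<close>.

  A planar grid is hard to disconnect, whereas a tree is disconnected by any vertex. The quantitative
  form used here is a coarse version of the Helly property of subtrees (\<open>coarse_Helly\<close>): sets of
  vertices that meet pairwise and that have no gap longer than \<open>r\<close> all come within \<open>r + 1\<close> of one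
  vertex. It applies to the images of the \<open>N\<close> crosses of the grid, the \<open>i\<close>-th of which is the union of
  row \<open>i\<close> and column \<open>i\<close>. A grid point lies on at most two crosses, so at least \<open>N / 2\<close> points are
  mapped into one ball of radius \<open>r + 1\<close>, which has at most \<open>(k + 1) ^ (r + 1)\<close> vertices if the tree
  has degree \<open>k\<close>.

  Two points with the same image are at distance at most \<open>c\<close>, which leaves room for only a constant
  times \<open>exp (2 c)\<close> grid points. Hence \<open>exp (R / 2)\<close> is at most a constant times
  \<open>(k + 1) ^ (2 L + c + 1) * exp (2 c)\<close> (\<open>exp_radius_le\<close>), and the logarithm of this inequality is a
  linear lower bound on \<open>L + c\<close>. Counting vertices and fibres, instead of estimating the diameter of
  the preimage of the ball, is what keeps the exponent linear: that diameter may be of order \<open>L * r\<close>,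
  which would give only a square root of \<open>R\<close>.\<close>

section \<open>Rooted trees\<close>

lemma rtrancl_imp_distinct_path:
  assumes "(u, v) \<in> E\<^sup>*"
  obtains p where "p \<noteq> []" "hd p = u" "last p = v" "distinct p"
    "successively (\<lambda>x y. (x, y) \<in> E) p"
  using assms
proof (induction arbitrary: thesis rule: converse_rtrancl_induct)
  case base
  show ?case
    by (rule base[of "[v]"]) auto
next
  case (step x y)
  obtain p where p: "p \<noteq> []" "hd p = y" "last p = v" "distinct p"
    "successively (\<lambda>x y. (x, y) \<in> E) p"
    using step.IH by blast
  show ?case
  proof (cases "x \<in> set p")
    case False
    then show ?thesis
      using p step.hyps by (intro step.prems[of "x # p"]) (auto simp: successively_Cons)
  next
    case True
    then obtain ys zs where "p = ys @ x # zs"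
      by (meson split_list)
    then show ?thesis
      using p by (intro step.prems[of "x # zs"]) (auto simp: successively_append_iff)
  qed
qed

locale rooted_tree =
  fixes V :: "'b set" and E :: "'b rel" and root :: 'b
  assumes tree: "tree_graph V E" and root: "root \<in> V"
begin

abbreviation "d \<equiv> graph_dist E"
abbreviation "depth x \<equiv> d root x"

text \<open>Descendants are described by distances, so that walks can be followed without choosing
  paths: \<open>x\<close> is below \<open>v\<close> iff some shortest walk from the root to \<open>x\<close> passes through \<open>v\<close>.\<close>

definition below :: "'b \<Rightarrow> 'b set"
  where "below v = {x \<in> V. depth x = depth v + d v x}"

lemma connected: "connected_graph V E"
  using tree by (simp add: tree_graph_def)

lemma edge_in: "(x, y) \<in> E \<Longrightarrow> x \<in> V" "(x, y) \<in> E \<Longrightarrow> y \<in> V"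
  and edge_sym: "(x, y) \<in> E \<Longrightarrow> (y, x) \<in> E"
  and edge_irrefl: "(x, x) \<notin> E"
  using connected by (auto simp: connected_graph_def simple_graph_def dest: symD irreflD)

lemma dist_le: "(x, y) \<in> E ^^ n \<Longrightarrow> d x y \<le> n"
  unfolding graph_dist_def by (rule Least_le)

lemma dist_walk: "x \<in> V \<Longrightarrow> y \<in> V \<Longrightarrow> (x, y) \<in> E ^^ d x y"
  using connected unfolding connected_graph_def graph_dist_def
  by (metis (mono_tags, lifting) LeastI_ex rtrancl_imp_relpow)

lemma dist_commute: "d x y = d y x"
  using Metric_space.commute[OF Metric_space_graph[OF connected], of x y] by simp

lemma dist_eq_0: "x \<in> V \<Longrightarrow> y \<in> V \<Longrightarrow> d x y = 0 \<longleftrightarrow> x = y"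
  using Metric_space.zero[OF Metric_space_graph[OF connected], of x y] by simp

lemma dist_triangle: "x \<in> V \<Longrightarrow> y \<in> V \<Longrightarrow> z \<in> V \<Longrightarrow> d x z \<le> d x y + d y z"
  using Metric_space.triangle[OF Metric_space_graph[OF connected], of x y z] by simp

lemma dist_edge: "(x, y) \<in> E \<Longrightarrow> d x y \<le> 1"
  by (rule dist_le) simp

lemma dist_first_step:
  assumes "x \<in> V" "y \<in> V" "x \<noteq> y"
  obtains z where "(x, z) \<in> E" "d x y = Suc (d z y)"
proof -
  have "d x y \<noteq> 0"
    using assms dist_eq_0 by blast
  then obtain n where n: "d x y = Suc n"
    using not0_implies_Suc by blast
  then have "(x, y) \<in> E ^^ Suc n"
    using dist_walk[OF assms(1,2)] by simp
  then obtain z where z: "(x, z) \<in> E" "(z, y) \<in> E ^^ n"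
    by (blast dest: relpow_Suc_D2)
  then have "d x y \<le> 1 + d z y"
    using dist_triangle[of x z y] dist_edge assms edge_in
    by (metis add_right_mono order_trans)
  then have "d x y = Suc (d z y)"
    using dist_le[OF z(2)] n by linarith
  then show thesis
    using that z by blast
qed

lemma dist_last_step:
  assumes "x \<in> V" "y \<in> V" "x \<noteq> y"
  obtains z where "(z, y) \<in> E" "d x y = Suc (d x z)"
  using dist_first_step[of y x] assms edge_sym dist_commute by metis

text \<open>A shortest walk from the root ascends strictly in depth, so \<open>p\<close> cannot come before \<open>q\<close>.\<close>

lemma root_reaches_avoiding:
  assumes "q \<in> V" "q \<noteq> p" "depth q \<le> depth p"
  shows "(root, q) \<in> (E \<inter> (- {p}) \<times> (- {p}))\<^sup>*"
  using assms
proof (induction "depth q" arbitrary: q)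
  case 0
  then show ?case
    using dist_eq_0[OF root] by auto
next
  case (Suc n)
  then have "root \<noteq> q"
    using dist_eq_0[OF root] by (metis nat.distinct(1))
  then obtain z where z: "(z, q) \<in> E" "depth q = Suc (depth z)"
    using dist_last_step[OF root] Suc.prems by metis
  then have "z \<noteq> p"
    using Suc.prems by auto
  then have "(root, z) \<in> (E \<inter> (- {p}) \<times> (- {p}))\<^sup>*"
    using Suc z edge_in by auto
  then show ?case
    using z \<open>z \<noteq> p\<close> Suc.prems by (auto intro: rtrancl_into_rtrancl)
qed

text \<open>This is the only place where the absence of cycles enters: two neighbours of \<open>p\<close> that are not
  deeper than \<open>p\<close> are joined by a path through the root that misses \<open>p\<close>, and \<open>p\<close> closes that path to
  a cycle. In particular neighbours never have equal depth.\<close>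

lemma unique_parent:
  assumes "(p, q) \<in> E" "(p, q') \<in> E" "depth q \<le> depth p" "depth q' \<le> depth p"
  shows "q = q'"
proof (rule ccontr)
  assume "q \<noteq> q'"
  let ?F = "E \<inter> (- {p}) \<times> (- {p})"
  have "q \<noteq> p" "q' \<noteq> p"
    using assms edge_irrefl by auto
  then have reach: "(root, q) \<in> ?F\<^sup>*" "(root, q') \<in> ?F\<^sup>*"
    using root_reaches_avoiding assms edge_in by auto
  have "sym ?F"
    using edge_sym by (auto intro!: symI)
  then have "(q, q') \<in> ?F\<^sup>*"
    using reach by (meson rtrancl_trans sym_rtrancl symD)
  then obtain w where w: "w \<noteq> []" "hd w = q" "last w = q'" "distinct w"
    "successively (\<lambda>x y. (x, y) \<in> ?F) w"
    by (rule rtrancl_imp_distinct_path)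
  have walk: "successively (\<lambda>x y. (x, y) \<in> E) w"
    by (rule successively_mono[OF w(5)]) auto
  obtain z zs where zs: "w = q # z # zs"
    using w \<open>q \<noteq> q'\<close> by (metis last.simps list.exhaust_sel)
  have "p \<notin> set u" if "successively (\<lambda>x y. (x, y) \<in> ?F) u" "u \<noteq> []" "hd u \<noteq> p" for u
    using that by (induction u) (force simp: successively_Cons)+
  then have "p \<notin> set w"
    using w \<open>q \<noteq> p\<close> by blast
  then have "graph_cycle E (p # w)"
    using w walk zs assms edge_sym by (auto simp: graph_cycle_def successively_Cons)
  then show False
    using tree by (auto simp: tree_graph_def)
qed

lemma below_root: "below root = V"
  using dist_eq_0[OF root root] by (auto simp: below_def)

lemma below_self: "v \<in> V \<Longrightarrow> v \<in> below v"
  using dist_eq_0[of v v] by (auto simp: below_def)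

lemma below_child:
  assumes "v \<in> V" "x \<in> below v" "x \<noteq> v"
  obtains a where "(v, a) \<in> E" "depth a = Suc (depth v)" "x \<in> below a"
proof -
  have x: "x \<in> V" "depth x = depth v + d v x"
    using assms by (auto simp: below_def)
  obtain a where a: "(v, a) \<in> E" "d v x = Suc (d a x)"
    using dist_first_step[of v x] assms x by metis
  have "depth x \<le> depth a + d a x" "depth a \<le> depth v + d v a"
    using dist_triangle root x a edge_in by blast+
  then have "depth a = Suc (depth v)" "depth x = depth a + d a x"
    using a x dist_edge[OF a(1)] by linarith+
  then show thesis
    using that a x by (auto simp: below_def)
qed

text \<open>The set below \<open>v\<close> can only be left through \<open>v\<close>: the children of \<open>p\<close> are below \<open>v\<close> if \<open>p\<close> is,
  and so is the parent of \<open>p\<close>, unless \<open>p = v\<close>, because it is the last vertex before \<open>p\<close> on a shortest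
  walk from \<open>v\<close>.\<close>

lemma below_exit:
  assumes "v \<in> V" "(p, q) \<in> E" "p \<in> below v" "q \<notin> below v"
  shows "p = v"
proof (rule ccontr)
  assume "p \<noteq> v"
  have p: "p \<in> V" "q \<in> V" "depth p = depth v + d v p"
    using assms edge_in by (auto simp: below_def)
  obtain z where z: "(z, p) \<in> E" "d v p = Suc (d v z)"
    using dist_last_step[of v p] assms p \<open>p \<noteq> v\<close> by metis
  have zV: "z \<in> V"
    using z edge_in by blast
  have "depth p \<le> depth z + d z p" "depth z \<le> depth v + d v z"
    using dist_triangle root p zV assms by blast+
  then have depth_z: "depth z = depth v + d v z" "Suc (depth z) = depth p"
    using z p dist_edge[OF z(1)] by linarith+
  \<comment> \<open>Otherwise \<open>q\<close> would be the parent \<open>z\<close>, which is below \<open>v\<close>.\<close>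
  have "depth q > depth p"
    using unique_parent[of p q z] depth_z assms z zV edge_sym by (force simp: below_def)
  moreover have "depth q \<le> depth v + d v q" "d v q \<le> d v p + d p q"
    using dist_triangle root p assms by blast+
  ultimately have "depth q = depth v + d v q"
    using p dist_edge[OF assms(2)] by linarith
  then show False
    using assms p by (simp add: below_def)
qed

text \<open>By \<open>below_exit\<close> every walk from \<open>x\<close> to \<open>y\<close> passes through \<open>v\<close>.\<close>

lemma dist_exit_le:
  assumes "v \<in> V" "x \<in> below v" "y \<in> V" "y \<notin> below v"
  shows "d v x \<le> d x y"
proof -
  have "\<exists>m\<le>n. (x, v) \<in> E ^^ m" if "(x, y) \<in> E ^^ n" "x \<in> below v" for n x
    using that
  proof (induction n arbitrary: x)
    case 0
    then show ?case
      using assms by auto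
  next
    case (Suc n)
    obtain z where z: "(x, z) \<in> E" "(z, y) \<in> E ^^ n"
      using Suc.prems by (blast dest: relpow_Suc_D2)
    show ?case
    proof (cases "z \<in> below v")
      case True
      then obtain m where "m \<le> n" "(z, v) \<in> E ^^ m"
        using Suc.IH z by blast
      then show ?thesis
        using z by (meson Suc_le_mono relpow_Suc_I2)
    next
      case False
      then have "x = v"
        using below_exit assms z Suc.prems by blast
      then show ?thesis
        by (intro exI[of _ 0]) auto
    qed
  qed
  moreover have "(x, y) \<in> E ^^ d x y"
    using assms by (intro dist_walk) (auto simp: below_def)
  ultimately show ?thesis
    using dist_le assms(2) dist_commute by (metis order_trans)
qed

text \<open>In a rooted tree, pairwise intersecting subtrees have a common vertex, namely the deepest of
  their topmost vertices. Likewise, take here \<open>v\<close> as deep as possible such that some \<open>A i\<close> lies below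
  \<open>v\<close>. Each \<open>A j\<close> meets this \<open>A i\<close>, hence has a point below \<open>v\<close>. If it also has a point not below
  \<open>v\<close>, then it makes a jump of length at most \<open>r\<close> across \<open>v\<close>. If it lies entirely below \<open>v\<close>, then
  either it contains \<open>v\<close> or, since no child \<open>a\<close> of \<open>v\<close> can replace \<open>v\<close>, it jumps across such an
  \<open>a\<close>; this is why the radius is \<open>r + 1\<close>.

  The hypothesis \<open>conn\<close> says that any splitting of \<open>A i\<close> into two parts is bridged by a jump of length
  at most \<open>r\<close>; \<open>bound\<close> makes a deepest \<open>v\<close> exist.\<close>

lemma coarse_Helly:
  fixes A :: "'i \<Rightarrow> 'b set"
  assumes "I \<noteq> {}"
    and sub: "\<And>i. i \<in> I \<Longrightarrow> A i \<subseteq> V"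
    and meet: "\<And>i j. i \<in> I \<Longrightarrow> j \<in> I \<Longrightarrow> A i \<inter> A j \<noteq> {}"
    and conn: "\<And>i S. i \<in> I \<Longrightarrow> A i \<inter> S \<noteq> {} \<Longrightarrow> \<not> A i \<subseteq> S \<Longrightarrow>
      \<exists>x\<in>A i \<inter> S. \<exists>y\<in>A i - S. d x y \<le> r"
    and bound: "\<And>i x. i \<in> I \<Longrightarrow> x \<in> A i \<Longrightarrow> depth x \<le> B"
  obtains v where "v \<in> V" "\<And>i. i \<in> I \<Longrightarrow> \<exists>x\<in>A i. d v x \<le> Suc r"
proof -
  define P where "P v \<longleftrightarrow> v \<in> V \<and> (\<exists>i\<in>I. A i \<subseteq> below v)" for v
  have "P root"
    using \<open>I \<noteq> {}\<close> sub root by (auto simp: P_def below_root)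
  moreover have "depth v \<le> B" if Pv: "P v" for v
  proof -
    obtain i where i: "i \<in> I" "A i \<subseteq> below v"
      using Pv by (auto simp: P_def)
    then obtain x where "x \<in> A i"
      using meet by blast
    then have "depth v \<le> depth x"
      using i by (auto simp: below_def)
    then show ?thesis
      using bound[OF i(1) \<open>x \<in> A i\<close>] by simp
  qed
  ultimately have "\<exists>v. P v \<and> (\<forall>w. P w \<longrightarrow> depth w \<le> depth v)"
    by (intro ex_has_greatest_nat[of P root depth "Suc B"]) (simp_all add: less_Suc_eq_le)
  then obtain v where v: "P v" "\<And>w. P w \<Longrightarrow> depth w \<le> depth v"
    by metis
  then have vV: "v \<in> V"
    by (simp add: P_def)
  obtain i where i: "i \<in> I" "A i \<subseteq> below v"
    using v(1) unfolding P_def by blast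
  have "\<exists>x\<in>A j. d v x \<le> Suc r" if j: "j \<in> I" for j
  proof (cases "A j \<subseteq> below v")
    case False
    then obtain x y where "x \<in> A j \<inter> below v" "y \<in> A j - below v" "d x y \<le> r"
      using conn[OF j, of "below v"] meet[OF i(1) j] i by blast
    moreover from this have "d v x \<le> d x y"
      using vV sub[OF j] by (intro dist_exit_le) auto
    ultimately show ?thesis
      by (intro bexI[of _ x]) auto
  next
    case True
    obtain x where x: "x \<in> A j"
      using meet[OF j j] by blast
    show ?thesis
    proof (cases "x = v")
      case True
      then show ?thesis
        using x vV dist_eq_0[of v v] by force
    next
      case False
      then obtain a where a: "(v, a) \<in> E" "depth a = Suc (depth v)" "x \<in> below a"
        using below_child vV x \<open>A j \<subseteq> below v\<close> by blast
      then have "\<not> P a"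
        using v(2) by force
      then have "\<not> A j \<subseteq> below a"
        using a j edge_in by (auto simp: P_def)
      then obtain y z where yz: "y \<in> A j \<inter> below a" "z \<in> A j - below a" "d y z \<le> r"
        using conn[OF j, of "below a"] x a by blast
      have aV: "a \<in> V"
        using a edge_in by blast
      have "d a y \<le> r"
        using dist_exit_le[of a y z] aV sub[OF j] yz by auto
      moreover have "d v y \<le> d v a + d a y"
        using dist_triangle vV aV sub[OF j] yz by blast
      ultimately have "d v y \<le> Suc r"
        using dist_edge[OF a(1)] by linarith
      then show ?thesis
        using yz by blast
    qed
  qed
  then show thesis
    using that vV by blast
qed

lemma card_ball_le:
  assumes deg: "\<And>u. u \<in> V \<Longrightarrow> finite (E `` {u}) \<and> card (E `` {u}) = k" and "v \<in> V"
  shows "finite {x \<in> V. d v x \<le> n} \<and> card {x \<in> V. d v x \<le> n} \<le> (k + 1) ^ n"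
proof (induction n)
  case 0
  have "{x \<in> V. d v x \<le> 0} = {v}"
    using dist_eq_0 \<open>v \<in> V\<close> by auto
  then show ?case
    by simp
next
  case (Suc n)
  let ?B = "{x \<in> V. d v x \<le> n}"
  have sub: "{x \<in> V. d v x \<le> Suc n} \<subseteq> (\<Union>u\<in>?B. insert u (E `` {u}))"
  proof
    fix x
    assume x: "x \<in> {x \<in> V. d v x \<le> Suc n}"
    show "x \<in> (\<Union>u\<in>?B. insert u (E `` {u}))"
    proof (cases "x = v")
      case True
      then show ?thesis
        using x dist_eq_0[of v v] by auto
    next
      case False
      then obtain z where "(z, x) \<in> E" "d v x = Suc (d v z)"
        using dist_last_step[of v x] x \<open>v \<in> V\<close> by blast
      then show ?thesis
        using x edge_in by auto
    qed
  qed
  have fin: "finite (\<Union>u\<in>?B. insert u (E `` {u}))"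
    using Suc.IH deg by auto
  have "card (\<Union>u\<in>?B. insert u (E `` {u})) \<le> (\<Sum>u\<in>?B. card (insert u (E `` {u})))"
    using Suc.IH by (intro card_UN_le) auto
  also have "\<dots> \<le> (\<Sum>u\<in>?B. k + 1)"
    using deg by (intro sum_mono) (auto simp: card_insert_if)
  also have "\<dots> \<le> (k + 1) ^ n * (k + 1)"
    using Suc.IH by (simp only: sum_constant of_nat_id mult_le_mono1)
  finally show ?case
    using card_mono[OF fin sub] finite_subset[OF sub fin] by (auto simp: mult.commute)
qed

end

section \<open>Maps from a square grid to a tree\<close>

lemma nat_interval_switch:
  fixes P :: "nat \<Rightarrow> bool"
  assumes "P s" "\<not> P t" "s < L" "t < L"
  obtains u w where "u < L" "w < L" "P u" "\<not> P w" "u = Suc w \<or> w = Suc u"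
proof -
  have *: "\<exists>u. s \<le> u \<and> u < t \<and> Q u \<and> \<not> Q (Suc u)" if "Q s" "\<not> Q t" "s \<le> t"
    for Q :: "nat \<Rightarrow> bool" and s t
    using that(3,1,2)
  proof (induction rule: dec_induct)
    case (step n)
    then show ?case
      by (metis less_Suc_eq order_refl)
  qed simp
  show thesis
  proof (cases "s \<le> t")
    case True
    then obtain u where "u < t" "P u" "\<not> P (Suc u)"
      using *[of P s t] assms by auto
    then show thesis
      using that[of u "Suc u"] assms(4) by simp
  next
    case False
    then obtain u where "u < s" "\<not> P u" "P (Suc u)"
      using *[of "\<lambda>x. \<not> P x" t s] assms by auto
    then show thesis
      using that[of "Suc u" u] assms(3) by simp
  qed
qed

definition cross :: "nat \<Rightarrow> nat \<Rightarrow> (nat \<times> nat) set"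
  where "cross L i = {i} \<times> {..<L} \<union> {..<L} \<times> {i}"

definition grid_adjacent :: "nat \<times> nat \<Rightarrow> nat \<times> nat \<Rightarrow> bool"
  where "grid_adjacent p q \<longleftrightarrow>
    fst p = fst q \<and> (snd p = Suc (snd q) \<or> snd q = Suc (snd p)) \<or>
    snd p = snd q \<and> (fst p = Suc (fst q) \<or> fst q = Suc (fst p))"

lemma cross_switch:
  assumes "p \<in> cross L i" "q \<in> cross L i" "P p" "\<not> P q" "i < L"
  obtains p' q' where "p' \<in> cross L i" "q' \<in> cross L i" "P p'" "\<not> P q'" "grid_adjacent p' q'"
proof -
  have arm: "\<exists>p'\<in>cross L i. \<exists>q'\<in>cross L i. P p' \<and> \<not> P q' \<and> grid_adjacent p' q'"
    if st: "P (g s)" "\<not> P (g t)" "s < L" "t < L" and g: "g = Pair i \<or> g = (\<lambda>a. (a, i))"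
    for g s t
  proof -
    obtain u w where uw: "u < L" "w < L" "P (g u)" "\<not> P (g w)" "u = Suc w \<or> w = Suc u"
      using nat_interval_switch[of "\<lambda>u. P (g u)" s t L] st by blast
    then have "g u \<in> cross L i" "g w \<in> cross L i" "grid_adjacent (g u) (g w)"
      using g by (auto simp: cross_def grid_adjacent_def)
    then show ?thesis
      using uw by blast
  qed
  have on_arm: "\<exists>g s. x = g s \<and> s < L \<and> (g = Pair i \<or> g = (\<lambda>a. (a, i)))" if "x \<in> cross L i" for x
    using that by (auto simp: cross_def)
  have "\<exists>p'\<in>cross L i. \<exists>q'\<in>cross L i. P p' \<and> \<not> P q' \<and> grid_adjacent p' q'"
  proof (cases "P (i, i)")
    case True
    obtain g t where g: "q = g t" "t < L" "g = Pair i \<or> g = (\<lambda>a. (a, i))"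
      using on_arm[OF assms(2)] by metis
    then have "P (g i)"
      using True by auto
    then show ?thesis
      using g assms by (intro arm[of g i t]) auto
  next
    case False
    obtain g t where g: "p = g t" "t < L" "g = Pair i \<or> g = (\<lambda>a. (a, i))"
      using on_arm[OF assms(1)] by metis
    then have "\<not> P (g i)"
      using False by auto
    then show ?thesis
      using g assms by (intro arm[of g t i]) auto
  qed
  then show thesis
    using that by blast
qed

text \<open>Crosses \<open>i\<close> and \<open>j\<close> share the point \<open>(i, j)\<close>, so that \<open>coarse_Helly\<close> yields a vertex \<open>v\<close> near the
  image of every cross. The set \<open>Q\<close> of grid points mapped near \<open>v\<close> meets all crosses, and the
  index of a cross through a point is one of its two coordinates; this gives \<open>L \<le> 2 * card Q\<close>.\<close>

lemma (in rooted_tree) grid_side_le: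
  fixes g :: "nat \<times> nat \<Rightarrow> 'b"
  assumes deg: "\<And>u. u \<in> V \<Longrightarrow> finite (E `` {u}) \<and> card (E `` {u}) = k"
    and gV: "\<And>p. p \<in> {..<L} \<times> {..<L} \<Longrightarrow> g p \<in> V"
    and adj: "\<And>p q. p \<in> {..<L} \<times> {..<L} \<Longrightarrow> q \<in> {..<L} \<times> {..<L} \<Longrightarrow> grid_adjacent p q \<Longrightarrow>
      d (g p) (g q) \<le> r"
    and fibre: "\<And>w. card {p \<in> {..<L} \<times> {..<L}. g p = w} \<le> M"
  shows "L \<le> 2 * ((k + 1) ^ Suc r * M)"
proof (cases "L = 0")
  case False
  let ?G = "{..<L} \<times> {..<L}"
  have crossG: "cross L i \<subseteq> ?G" if "i < L" for i
    using that by (auto simp: cross_def)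
  have conn: "\<exists>x\<in>g ` cross L i \<inter> S. \<exists>y\<in>g ` cross L i - S. d x y \<le> r"
    if i: "i \<in> {..<L}" and S: "g ` cross L i \<inter> S \<noteq> {}" "\<not> g ` cross L i \<subseteq> S" for i S
  proof -
    obtain p q where pq: "p \<in> cross L i" "q \<in> cross L i" "g p \<in> S" "\<not> g q \<in> S"
      using S by blast
    then obtain p' q' where "p' \<in> cross L i" "q' \<in> cross L i" "g p' \<in> S" "\<not> g q' \<in> S"
      "grid_adjacent p' q'"
      using cross_switch[of p L i q "\<lambda>p. g p \<in> S"] i by (metis (no_types, lifting) lessThan_iff)
    moreover from this have "d (g p') (g q') \<le> r"
      using adj crossG i by blast
    ultimately show ?thesis
      by blast
  qed
  obtain v where v: "v \<in> V" "\<And>i. i \<in> {..<L} \<Longrightarrow> \<exists>x\<in>g ` cross L i. d v x \<le> Suc r"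
  proof (rule coarse_Helly[of "{..<L}" "\<lambda>i. g ` cross L i" r "Max ((\<lambda>p. depth (g p)) ` ?G)"])
    show "g ` cross L i \<inter> g ` cross L j \<noteq> {}" if "i \<in> {..<L}" "j \<in> {..<L}" for i j
    proof -
      have "(i, j) \<in> cross L i \<inter> cross L j"
        using that by (auto simp: cross_def)
      then show ?thesis
        by blast
    qed
    show "g ` cross L i \<subseteq> V" if "i \<in> {..<L}" for i
      using that gV crossG by blast
    show "depth x \<le> Max ((\<lambda>p. depth (g p)) ` ?G)" if "i \<in> {..<L}" "x \<in> g ` cross L i" for i x
      using that crossG by (intro Max_ge) auto
  qed (use False conn in auto)
  let ?B = "{x \<in> V. d v x \<le> Suc r}"
  define Q where "Q = {p \<in> ?G. g p \<in> ?B}"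
  have ball: "finite ?B" "card ?B \<le> (k + 1) ^ Suc r"
    using card_ball_le[OF deg v(1)] by blast+
  have finQ: "finite Q"
    by (simp add: Q_def)
  have "{..<L} \<subseteq> fst ` Q \<union> snd ` Q"
  proof
    fix i
    assume i: "i \<in> {..<L}"
    obtain p where "p \<in> cross L i" "d v (g p) \<le> Suc r"
      using v(2)[OF i] by blast
    moreover from this have "p \<in> Q"
      using i crossG gV by (auto simp: Q_def)
    ultimately show "i \<in> fst ` Q \<union> snd ` Q"
      by (force simp: cross_def)
  qed
  then have "L \<le> card (fst ` Q \<union> snd ` Q)"
    using card_mono[of "fst ` Q \<union> snd ` Q" "{..<L}"] finQ by simp
  also have "\<dots> \<le> 2 * card Q"
    using card_Un_le[of "fst ` Q" "snd ` Q"] card_image_le[OF finQ, of fst]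
      card_image_le[OF finQ, of snd] by linarith
  also have "card Q \<le> (\<Sum>w\<in>?B. card {p \<in> ?G. g p = w})"
  proof -
    have "Q = (\<Union>w\<in>?B. {p \<in> ?G. g p = w})"
      by (auto simp: Q_def)
    then show ?thesis
      using card_UN_le[OF ball(1)] by simp
  qed
  also have "\<dots> \<le> (\<Sum>w\<in>?B. M)"
    by (intro sum_mono fibre)
  also have "\<dots> \<le> (k + 1) ^ Suc r * M"
    using ball by simp
  finally show ?thesis
    by simp
qed simp

section \<open>A Euclidean grid on a horosphere\<close>

text \<open>The mesh is the height \<open>snd x\<close>, so that the hyperbolic distances between grid points do not depend
  on \<open>x\<close>.\<close>

definition horosphere_grid :: "'a::euclidean_space \<times> real \<Rightarrow> 'a \<Rightarrow> 'a \<Rightarrow> nat \<times> nat \<Rightarrow> 'a \<times> real"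
  where "horosphere_grid x e e' p =
    (fst x + (snd x * real (fst p)) *\<^sub>R e + (snd x * real (snd p)) *\<^sub>R e', snd x)"

lemma cosh_hyperbolic_dist:
  assumes "p \<in> upper_half_space" "q \<in> upper_half_space"
  shows "cosh (hyperbolic_dist p q) = 1 + (dist p q)\<^sup>2 / (2 * snd p * snd q)"
  using assms by (simp add: hyperbolic_dist_def upper_half_space_def cosh_arcosh_real)

lemma cosh_dist_horosphere_grid:
  assumes "x \<in> upper_half_space" "e \<in> Basis" "e' \<in> Basis" "e \<noteq> e'"
  shows "horosphere_grid x e e' p \<in> upper_half_space"
    and "cosh (hyperbolic_dist (horosphere_grid x e e' p) (horosphere_grid x e e' q)) =
      1 + ((real (fst p) - real (fst q))\<^sup>2 + (real (snd p) - real (snd q))\<^sup>2) / 2"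
proof -
  have h: "0 < snd x"
    using assms by (simp add: upper_half_space_def)
  then show in_space: "horosphere_grid x e e' p \<in> upper_half_space" for p
    by (simp add: upper_half_space_def horosphere_grid_def)
  define a b where "a = snd x * (real (fst p) - real (fst q))"
    and "b = snd x * (real (snd p) - real (snd q))"
  have "(dist (horosphere_grid x e e' p) (horosphere_grid x e e' q))\<^sup>2 = (norm (a *\<^sub>R e + b *\<^sub>R e'))\<^sup>2"
    by (simp add: horosphere_grid_def dist_Pair_Pair dist_norm a_def b_def algebra_simps)
  also have "\<dots> = a\<^sup>2 + b\<^sup>2"
    using assms by (simp only: power2_norm_eq_inner)
      (simp add: inner_add_left inner_add_right inner_not_same_Basis inner_same_Basis power2_eq_square)
  finally show "cosh (hyperbolic_dist (horosphere_grid x e e' p) (horosphere_grid x e e' q)) =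
      1 + ((real (fst p) - real (fst q))\<^sup>2 + (real (snd p) - real (snd q))\<^sup>2) / 2"
    using h by (simp add: cosh_hyperbolic_dist[OF in_space in_space])
      (simp add: horosphere_grid_def a_def b_def power2_eq_square field_simps)
qed


lemma card_bounded_diameter_le:
  fixes Q :: "(nat \<times> nat) set"
  assumes "\<And>p q. p \<in> Q \<Longrightarrow> q \<in> Q \<Longrightarrow> fst p \<le> fst q + K \<and> snd p \<le> snd q + K"
  shows "card Q \<le> (2 * K + 1)\<^sup>2"
proof (cases "Q = {}")
  case False
  then obtain a b where ab: "(a, b) \<in> Q"
    by auto
  let ?S = "{a - K..a + K} \<times> {b - K..b + K}"
  have "Q \<subseteq> ?S"
  proof
    fix p
    assume "p \<in> Q"
    then show "p \<in> ?S"
      using assms[of p "(a, b)"] assms[of "(a, b)" p] ab by (cases p) auto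
  qed
  then have "card Q \<le> card ?S"
    by (intro card_mono) auto
  also have "\<dots> = card {a - K..a + K} * card {b - K..b + K}"
    by (rule card_cartesian_product)
  also have "\<dots> \<le> (2 * K + 1) * (2 * K + 1)"
    by (intro mult_le_mono) auto
  finally show ?thesis
    by (simp only: power2_eq_square)
qed simp

lemma abs_diff_nat_le_square: "\<bar>real a - real b\<bar> \<le> (real a - real b)\<^sup>2"
proof -
  have "\<bar>int a - int b\<bar> \<le> (int a - int b)\<^sup>2"
    using self_le_power[of "\<bar>int a - int b\<bar>" 2] by (cases "a = b") auto
  then have "real_of_int \<bar>int a - int b\<bar> \<le> real_of_int ((int a - int b)\<^sup>2)"
    by (simp only: of_int_le_iff)
  then show ?thesis
    by simp
qed

lemma cosh_le_exp: "0 \<le> c \<Longrightarrow> cosh c \<le> exp (c::real)"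
  by (simp add: cosh_field_def)

lemma half_exp_less_cosh: "exp c / 2 < cosh (c::real)"
  by (simp add: cosh_field_def)

section \<open>Exponential growth against distortion\<close>

text \<open>The side \<open>N\<close>, about \<open>exp (R / 2) / 2\<close>, is chosen such that the farthest grid point from \<open>x\<close> still
  satisfies \<open>cosh (hyperbolic_dist x p) \<le> 1 + exp R / 4 < cosh R\<close>; \<open>6 \<le> R\<close> absorbs the additive
  constant here and the rounding of \<open>N\<close>. In a fibre of \<open>f\<close> the hyperbolic cosine of the distance is at
  most \<open>exp c\<close>, so the coordinate differences have squares at most \<open>2 * exp c\<close>. Being integers, they
  are bounded by their squares; taking square roots would only improve the coefficient of \<open>c\<close> in the
  exponent.\<close>

lemma exp_radius_le:
  fixes x :: "'a::euclidean_space \<times> real" and e e' :: 'a and V :: "'b set"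
  assumes e: "e \<in> Basis" "e' \<in> Basis" "e \<noteq> e'"
    and x: "x \<in> upper_half_space"
    and reg: "regular_tree V E"
    and deg: "\<And>u. u \<in> V \<Longrightarrow> finite (E `` {u}) \<and> card (E `` {u}) = k"
    and qi: "quasi_isometric_embedding_on (mball_of hyperbolic_space x R) hyperbolic_space
      (graph_metric V E) L c f"
    and R: "6 \<le> R"
  shows "exp (R / 2) \<le> 200 * real (k + 1) powr (2 * L + c + 1) * exp (2 * c)"
proof -
  obtain root where "root \<in> V"
    using reg by (metis regular_tree_def infinite_imp_nonempty ex_in_conv)
  then interpret rooted_tree V E root
    using reg by unfold_locales (auto simp: regular_tree_def)
  have Lc: "0 < L" "0 \<le> c"
    using qi by (auto simp: quasi_isometric_embedding_on_def)
  define N where "N = nat \<lfloor>exp (R / 2) / 2\<rfloor>"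
  define r where "r = nat \<lfloor>2 * L + c\<rfloor>"
  define K where "K = nat \<lfloor>2 * exp c\<rfloor>"
  let ?h = "horosphere_grid x e e'"
  let ?B = "mball_of hyperbolic_space x R"
  have h_in: "?h p \<in> upper_half_space" for p
    by (rule cosh_dist_horosphere_grid(1)[OF x e])
  note cosh_h = cosh_dist_horosphere_grid(2)[OF x e]
  have nonneg: "0 \<le> hyperbolic_dist p q" for p q :: "'a \<times> real"
    using Metric_space.nonneg[OF Metric_space_hyperbolic] .
  have N_le: "real N \<le> exp (R / 2) / 2"
    unfolding N_def by (rule of_nat_floor) simp
  have "exp (R / 2) \<ge> 4"
    using exp_ge_add_one_self[of "R / 2"] R by linarith
  moreover have "real N \<ge> exp (R / 2) / 2 - 1"
    unfolding N_def by linarith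
  ultimately have N_ge: "exp (R / 2) / 4 \<le> real N"
    by linarith
  have expR: "exp R = exp (R / 2) * exp (R / 2)"
    by (simp flip: exp_add)
  have "exp R > 4"
    using exp_ge_add_one_self[of R] R by linarith
  have h_ball: "?h p \<in> ?B" if p: "p \<in> {..<N} \<times> {..<N}" for p
  proof -
    have le: "(real a)\<^sup>2 \<le> exp R / 4" if "a < N" for a
    proof -
      have "(real a)\<^sup>2 \<le> (exp (R / 2) / 2)\<^sup>2"
        using that N_le by (intro power_mono) auto
      then show ?thesis
        by (simp add: power2_eq_square expR)
    qed
    have "x = ?h (0, 0)"
      by (simp add: horosphere_grid_def)
    then have "cosh (hyperbolic_dist x (?h p)) = 1 + ((real (fst p))\<^sup>2 + (real (snd p))\<^sup>2) / 2"
      using cosh_h[of "(0, 0)" p] by simp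
    also have "\<dots> < cosh R"
    proof -
      have "fst p < N" "snd p < N"
        using p by auto
      then show ?thesis
        using le[of "fst p"] le[of "snd p"] half_exp_less_cosh[of R] \<open>exp R > 4\<close> by (simp add: field_simps)
    qed
    finally have "hyperbolic_dist x (?h p) < R"
      using cosh_real_nonneg_less_iff[of "hyperbolic_dist x (?h p)" R] nonneg R by simp
    then show ?thesis
      using x h_in by simp
  qed
  have fV: "f (?h p) \<in> V" if "p \<in> {..<N} \<times> {..<N}" for p
    using qi h_ball[OF that] mspace_graph_metric[OF reg]
    by (auto simp: quasi_isometric_embedding_on_def)
  have upper: "real (d (f y) (f z)) \<le> L * hyperbolic_dist y z + c"
    and lower: "1 / L * (hyperbolic_dist y z - c) \<le> real (d (f y) (f z))"
    if "y \<in> ?B" "z \<in> ?B" for y z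
    using qi that by (auto simp: quasi_isometric_embedding_on_def mdist_graph_metric[OF reg])
  \<comment> \<open>The factor 2 in \<open>r\<close>: adjacent grid points have distance \<open>arcosh (3 / 2) \<le> 2\<close>.\<close>
  have adj: "d (f (?h p)) (f (?h q)) \<le> r"
    if "p \<in> {..<N} \<times> {..<N}" "q \<in> {..<N} \<times> {..<N}" "grid_adjacent p q" for p q
  proof -
    have "cosh (hyperbolic_dist (?h p) (?h q)) \<le> 3 / 2"
      using that(3) by (auto simp: cosh_h grid_adjacent_def)
    also have "\<dots> \<le> cosh 2"
      using half_exp_less_cosh[of 2] exp_ge_add_one_self[of "2::real"] by simp
    finally have "hyperbolic_dist (?h p) (?h q) \<le> 2"
      using cosh_real_nonneg_le_iff[of "hyperbolic_dist (?h p) (?h q)" 2] nonneg by simp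
    then have "L * hyperbolic_dist (?h p) (?h q) \<le> L * 2"
      using Lc by simp
    then have "real (d (f (?h p)) (f (?h q))) \<le> 2 * L + c"
      using upper[OF h_ball h_ball, of p q] that by linarith
    then show ?thesis
      unfolding r_def by linarith
  qed
  have fibre: "card {p \<in> {..<N} \<times> {..<N}. f (?h p) = w} \<le> (2 * K + 1)\<^sup>2" for w
  proof (rule card_bounded_diameter_le)
    fix p q
    assume "p \<in> {p \<in> {..<N} \<times> {..<N}. f (?h p) = w}" "q \<in> {p \<in> {..<N} \<times> {..<N}. f (?h p) = w}"
    then have pq: "p \<in> {..<N} \<times> {..<N}" "q \<in> {..<N} \<times> {..<N}" "f (?h p) = f (?h q)"
      by auto
    then have "1 / L * (hyperbolic_dist (?h p) (?h q) - c) \<le> 0"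
      using lower[OF h_ball h_ball, of p q] dist_eq_0[of "f (?h q)" "f (?h q)"] fV by simp
    then have "hyperbolic_dist (?h p) (?h q) \<le> c"
      using Lc by (simp add: divide_le_0_iff)
    then have cosh_le: "cosh (hyperbolic_dist (?h p) (?h q)) \<le> exp c"
      using cosh_real_nonneg_le_iff[of "hyperbolic_dist (?h p) (?h q)" c] nonneg Lc cosh_le_exp[of c]
      by (meson order_trans)
    have twice_le: "s \<le> 2 * t" if "1 + s / 2 \<le> t" for s t :: real
      using that by simp
    have "(real (fst p) - real (fst q))\<^sup>2 + (real (snd p) - real (snd q))\<^sup>2 \<le> 2 * exp c"
      using cosh_le unfolding cosh_h by (rule twice_le)
    then have "\<bar>real (fst p) - real (fst q)\<bar> \<le> 2 * exp c" "\<bar>real (snd p) - real (snd q)\<bar> \<le> 2 * exp c"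
      using abs_diff_nat_le_square[of "fst p" "fst q"] abs_diff_nat_le_square[of "snd p" "snd q"]
        zero_le_power2[of "real (fst p) - real (fst q)"]
        zero_le_power2[of "real (snd p) - real (snd q)"] by linarith+
    then show "fst p \<le> fst q + K \<and> snd p \<le> snd q + K"
      unfolding K_def by linarith
  qed
  have "N \<le> 2 * ((k + 1) ^ Suc r * (2 * K + 1)\<^sup>2)"
    by (rule grid_side_le[OF deg fV adj fibre])
  then have "real N \<le> real (2 * ((k + 1) ^ Suc r * (2 * K + 1)\<^sup>2))"
    by (simp only: of_nat_le_iff)
  also have "\<dots> = 2 * (real (k + 1) ^ Suc r * (real (2 * K + 1))\<^sup>2)"
    by (simp only: of_nat_mult of_nat_power of_nat_numeral)
  also have "\<dots> \<le> 2 * (real (k + 1) powr (2 * L + c + 1) * (25 * exp (2 * c)))"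
  proof (intro mult_left_mono mult_mono)
    have "real (Suc r) \<le> 2 * L + c + 1"
      using Lc unfolding r_def by (simp add: of_nat_floor)
    then have "real (k + 1) powr real (Suc r) \<le> real (k + 1) powr (2 * L + c + 1)"
      by (intro powr_mono) auto
    then show "real (k + 1) ^ Suc r \<le> real (k + 1) powr (2 * L + c + 1)"
      by (subst (asm) powr_realpow) auto
    have "real K \<le> 2 * exp c"
      unfolding K_def by (rule of_nat_floor) simp
    moreover have "1 \<le> exp c"
      using Lc by simp
    ultimately have "real (2 * K + 1) \<le> 5 * exp c"
      by linarith
    then have "(real (2 * K + 1))\<^sup>2 \<le> (5 * exp c)\<^sup>2"
      by (intro power_mono) auto
    also have "\<dots> = 25 * exp (2 * c)"
      by (simp add: power_mult_distrib flip: exp_double)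
    finally show "(real (2 * K + 1))\<^sup>2 \<le> 25 * exp (2 * c)" .
  qed auto
  finally show ?thesis
    using N_ge by simp
qed

theorem corollary1:
  fixes x\<^sub>0 :: "'a::euclidean_space \<times> real"
    and V :: "'b set" and E :: "'b rel" and y\<^sub>0 :: 'b
  assumes "3 \<le> DIM('a \<times> real)"
    and "x\<^sub>0 \<in> mspace hyperbolic_space"
    and "regular_tree V E"
    and "y\<^sub>0 \<in> V"
  shows "\<exists>C>0. \<exists>R\<^sub>0>0. \<forall>R\<ge>R\<^sub>0.
    inverse C * R \<le> distortion_growth hyperbolic_space x\<^sub>0 (graph_metric V E) y\<^sub>0 R \<and>
    distortion_growth hyperbolic_space x\<^sub>0 (graph_metric V E) y\<^sub>0 R \<le> C * R"
proof -
  obtain k where deg: "\<And>u. u \<in> V \<Longrightarrow> finite (E `` {u}) \<and> card (E `` {u}) = k"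
    using assms(3) by (auto simp: regular_tree_def)
  have x: "x\<^sub>0 \<in> upper_half_space"
    using assms(2) by simp
  have "2 \<le> card (Basis :: 'a set)"
    using assms(1) by simp
  then obtain e e' :: 'a where e: "e \<in> Basis" "e' \<in> Basis" "e \<noteq> e'"
    by (meson card_2_iff' obtain_subset_with_card_n subsetD)
  define A where "A = ln 200 + ln (real (k + 1))"
  define B where "B = 2 * ln (real (k + 1)) + 2"
  have B: "2 \<le> B"
    by (simp add: B_def)
  have bounds: "inverse (4 * B) * R \<le> distortion_growth hyperbolic_space x\<^sub>0 (graph_metric V E) y\<^sub>0 R \<and>
    distortion_growth hyperbolic_space x\<^sub>0 (graph_metric V E) y\<^sub>0 R \<le> 4 * B * R"
    if R: "max 6 (4 * A) \<le> R" for R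
  proof -
    let ?S = "{L + c | L c. \<exists>f. quasi_isometric_embedding_on (mball_of hyperbolic_space x\<^sub>0 R)
      hyperbolic_space (graph_metric V E) L c f \<and> f x\<^sub>0 = y\<^sub>0}"
    have const: "1 + 2 * R \<in> ?S"
      using quasi_isometric_embedding_on_const[of x\<^sub>0 hyperbolic_space y\<^sub>0 "graph_metric V E" R]
        assms mspace_graph_metric[OF assms(3)] R by fastforce
    have "inverse (4 * B) * R \<le> L + c"
      if qi: "quasi_isometric_embedding_on (mball_of hyperbolic_space x\<^sub>0 R) hyperbolic_space
        (graph_metric V E) L c f" for L c f
    proof -
      have Lc: "0 < L" "0 \<le> c"
        using qi by (auto simp: quasi_isometric_embedding_on_def)
      have "R / 2 = ln (exp (R / 2))"
        by simp
      also have "\<dots> \<le> ln (200 * real (k + 1) powr (2 * L + c + 1) * exp (2 * c))"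
        using exp_radius_le[OF e x assms(3) deg qi] R by (subst ln_le_cancel_iff) auto
      also have "\<dots> = ln 200 + (2 * L + c + 1) * ln (real (k + 1)) + 2 * c"
        by (simp add: ln_mult ln_powr del: of_nat_Suc of_nat_add)
      also have "\<dots> = A + B * (L + c) - (c * ln (real (k + 1)) + 2 * L)"
        by (simp add: A_def B_def algebra_simps)
      also have "\<dots> \<le> A + B * (L + c)"
      proof -
        have "0 \<le> c * ln (real (k + 1))"
          using Lc by (intro mult_nonneg_nonneg) auto
        then show ?thesis
          using Lc by linarith
      qed
      finally have "R / 4 \<le> B * (L + c)"
        using R by simp
      then show ?thesis
        using B by (simp add: field_simps)
    qed
    then have "inverse (4 * B) * R \<le> Inf ?S"
      using const by (intro cInf_greatest) auto
    moreover have "Inf ?S \<le> 1 + 2 * R"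
      using const bdd_below_distortion by (rule cInf_lower)
    moreover have "8 * R \<le> 4 * B * R"
      using B R by (intro mult_right_mono) auto
    ultimately show ?thesis
      unfolding distortion_growth_def using R by linarith
  qed
  show ?thesis
    using bounds B by (intro exI[of _ "4 * B"] conjI exI[of _ "max 6 (4 * A)"] allI impI) auto
qed

end
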